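(* Let $\mathcal{F}$ be a fragment of $\mathcal{H}$ and $b\in\mathbb{N}$. If $\mathcal{F}$ is reducible to $\mathcal{F}_{\infty,b}$, then the reduction cores of $\mathcal{F}$ and of $\mathcal{F}_{\infty,b}$ are the same.
   Context: Term variables $x_1,x_2,\dots$ and predicate variables $P,P_0,P_1,\dots$ (each predicate variable has an arity in $\mathbb{N}^*$) are drawn from infinite enumerable sets. Atoms, literals and clauses. - An atom is $P(x_{k_1},\dots,x_{k_a})$ with $P$ of arity $a$. - A (Horn) clause $C$ has at most one positive literal, its head $h(C)$, and a finite set $b(C)$ of negative literals, its body. It is written $h(C)\leftarrow b(C)$. - The body size $|C|$ is the number of body literals. - $\mathcal{H}$ is the set of all such function-free second-order Horn clauses. Substitutions and SLD-resolution. - Substitutions map term variables to term variables and predicate variables to predicate variables of the same arity. Most general unifiers (m.g.u.) are defined with respect to them. - An SLD-resolution inference $C_1,C_2\vdash C$ is binary resolution without factoring. A body literal of one premise is unified by an m.g.u. with the head of the other premise. The resolvent consists of the remaining literals with the m.g.u. applied. - $S^0(T)=T$ and $S^n(T)=\{C\mid C_1\in S^{n-1}(T),C_2\in T,C_1,C_2\vdash C\}$. Write $T\vdash^* C$ iff $C\in\bigcup_n S^n(T)$. Redundancy and reduction cores. - A clause $C$ is redundant in $T\cup\{C\}$ iff $T\vdash^* C$. - A theory $T$ is redundant to $T'\subseteq T$ if $T'\vdash^*C$ for all $C\in T$. - A theory is reduced if it contains no redundant clause. - A reduction core of a (possibly infinite) theory $T$ is a finite $T'\subseteq T$ such that $T$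 is redundant to $T'$ and $T'$ is reduced. Fragments. - $\mathcal{F}_{a,b}$ denotes the clauses of $\mathcal{F}$ whose literals all have arity at most $a$ and whose body size is at most $b$; $\infty$ means no restriction. - Fragments are considered modulo variable renaming and contain only the most general clauses up to variable unification. - $\mathcal{F}$ is reducible to $\mathcal{F}_{\infty,b}$ if, for every $C\in\mathcal{F}$ with $b<|C|$, there exists $b'<|C|$ such that $C$ is the resolvent of an SLD-inference whose premises lie in $\mathcal{F}_{\infty,b'}$.
   Formalization: Equality of the reduction cores is claimed only for fragments without facts (it fails with facts); with facts, the cores of F_{∞,b} are shown to be exactly the cores of F contained in F_{∞,b}. Body literals are counted with multiplicity (merging equal literals also breaks the claim). *)

theory Defs
  imports "HOL-Library.Multiset" "HOL-Library.Extended_Nat"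
begin

section \<open>Function-free second-order Horn clauses\<close>

text \<open>Term variables are natural numbers. A predicate variable carries its arity, so that there are
  infinitely many predicate variables of each arity.\<close>

type_synonym tvar = nat

datatype pvar = PVar (pindex: nat) (arity: nat)

datatype atom = Atom (pred: pvar) (args: "tvar list")

definition wf_atom :: "atom \<Rightarrow> bool" where
  "wf_atom A \<longleftrightarrow> 1 \<le> arity (pred A) \<and> length (args A) = arity (pred A)"

text \<open>Body literals are counted by occurrence: resolution is performed without factoring, so two
  body literals that become equal under a unifier are not merged.\<close>

datatype clause = Clause (head: "atom option") (body: "atom multiset")

definition clause_atoms :: "clause \<Rightarrow> atom set" where
  "clause_atoms C = set_option (head C) \<union> set_mset (body C)"

definition horn :: "clause set" ("\<H>") where
  "\<H> = {C. \<forall>A\<in>clause_atoms C. wf_atom A}"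

definition body_size :: "clause \<Rightarrow> nat" where
  "body_size C = size (body C)"

definition is_fact :: "clause \<Rightarrow> bool" where
  "is_fact C \<longleftrightarrow> head C \<noteq> None \<and> body C = {#}"

definition tvars :: "clause \<Rightarrow> tvar set" where
  "tvars C = (\<Union>A\<in>clause_atoms C. set (args A))"

definition pvars :: "clause \<Rightarrow> pvar set" where
  "pvars C = pred ` clause_atoms C"


section \<open>Substitutions and most general unifiers\<close>

type_synonym subst = "(tvar \<Rightarrow> tvar) \<times> (pvar \<Rightarrow> pvar)"

definition is_subst :: "subst \<Rightarrow> bool" where
  "is_subst \<sigma> \<longleftrightarrow> (\<forall>P. arity (snd \<sigma> P) = arity P)"

definition is_renaming :: "subst \<Rightarrow> bool" where
  "is_renaming \<sigma> \<longleftrightarrow> is_subst \<sigma> \<and> bij (fst \<sigma>) \<and> bij (snd \<sigma>)"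

definition comp_subst :: "subst \<Rightarrow> subst \<Rightarrow> subst" where
  "comp_subst \<rho> \<sigma> = (fst \<rho> \<circ> fst \<sigma>, snd \<rho> \<circ> snd \<sigma>)"

definition subst_atom :: "subst \<Rightarrow> atom \<Rightarrow> atom" where
  "subst_atom \<sigma> A = Atom (snd \<sigma> (pred A)) (map (fst \<sigma>) (args A))"

definition subst_clause :: "subst \<Rightarrow> clause \<Rightarrow> clause" where
  "subst_clause \<sigma> C =
     Clause (map_option (subst_atom \<sigma>) (head C)) (image_mset (subst_atom \<sigma>) (body C))"

definition is_instance :: "clause \<Rightarrow> clause \<Rightarrow> bool" where
  "is_instance D C \<longleftrightarrow> (\<exists>\<sigma>. is_subst \<sigma> \<and> D = subst_clause \<sigma> C)"

definition is_variant :: "clause \<Rightarrow> clause \<Rightarrow> bool" where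
  "is_variant D C \<longleftrightarrow> (\<exists>\<sigma>. is_renaming \<sigma> \<and> D = subst_clause \<sigma> C)"

definition is_unifier :: "subst \<Rightarrow> atom \<Rightarrow> atom \<Rightarrow> bool" where
  "is_unifier \<sigma> A B \<longleftrightarrow> is_subst \<sigma> \<and> subst_atom \<sigma> A = subst_atom \<sigma> B"

definition is_mgu :: "subst \<Rightarrow> atom \<Rightarrow> atom \<Rightarrow> bool" where
  "is_mgu \<sigma> A B \<longleftrightarrow> is_unifier \<sigma> A B \<and>
     (\<forall>\<tau>. is_unifier \<tau> A B \<longrightarrow> (\<exists>\<rho>. is_subst \<rho> \<and> \<tau> = comp_subst \<rho> \<sigma>))"


section \<open>SLD-resolution\<close>

definition resolves_body_head :: "clause \<Rightarrow> clause \<Rightarrow> clause \<Rightarrow> bool" where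
  "resolves_body_head D E C \<longleftrightarrow> (\<exists>A B \<sigma>. A \<in># body D \<and> head E = Some B \<and> is_mgu \<sigma> A B \<and>
     C = subst_clause \<sigma> (Clause (head D) ((body D - {#A#}) + body E)))"

text \<open>The premises are renamed apart. Either premise may supply the body literal. Since every m.g.u.
  is admitted, the set of resolvents of two clauses is closed under renaming.\<close>

definition sld :: "clause \<Rightarrow> clause \<Rightarrow> clause \<Rightarrow> bool" where
  "sld C1 C2 C \<longleftrightarrow> (\<exists>D1 D2. is_variant D1 C1 \<and> is_variant D2 C2 \<and>
     tvars D1 \<inter> tvars D2 = {} \<and> pvars D1 \<inter> pvars D2 = {} \<and>
     (resolves_body_head D1 D2 C \<or> resolves_body_head D2 D1 C))"

fun S :: "nat \<Rightarrow> clause set \<Rightarrow> clause set" where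
  "S 0 T = T"
| "S (Suc n) T = {C. \<exists>C1\<in>S n T. \<exists>C2\<in>T. sld C1 C2 C}"

definition derives :: "clause set \<Rightarrow> clause \<Rightarrow> bool" (infix "\<turnstile>\<^sup>*" 50) where
  "T \<turnstile>\<^sup>* C \<longleftrightarrow> C \<in> (\<Union>n. S n T)"


section \<open>Redundancy and reduction cores\<close>

text \<open>For \<open>C \<notin> T\<close>, this says that \<open>C\<close> is redundant in \<open>T \<union> {C}\<close> iff \<open>T \<turnstile>\<^sup>* C\<close>.\<close>

definition redundant_clause :: "clause \<Rightarrow> clause set \<Rightarrow> bool" where
  "redundant_clause C T \<longleftrightarrow> (T - {C}) \<turnstile>\<^sup>* C"

definition redundant_to :: "clause set \<Rightarrow> clause set \<Rightarrow> bool" where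
  "redundant_to T T' \<longleftrightarrow> T' \<subseteq> T \<and> (\<forall>C\<in>T. T' \<turnstile>\<^sup>* C)"

definition reduced :: "clause set \<Rightarrow> bool" where
  "reduced T \<longleftrightarrow> (\<forall>C\<in>T. \<not> redundant_clause C T)"

definition reduction_core :: "clause set \<Rightarrow> clause set \<Rightarrow> bool" where
  "reduction_core T T' \<longleftrightarrow> finite T' \<and> T' \<subseteq> T \<and> redundant_to T T' \<and> reduced T'"


section \<open>Fragments\<close>

text \<open>No member is an instance of another one. Variants are instances of each other, so a fragment
  contains at most one representative of each clause modulo renaming.\<close>

definition fragment :: "clause set \<Rightarrow> bool" where
  "fragment F \<longleftrightarrow> F \<subseteq> \<H> \<and> (\<forall>C\<in>F. \<forall>D\<in>F. is_instance D C \<longrightarrow> D = C)"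

definition subfragment :: "clause set \<Rightarrow> enat \<Rightarrow> enat \<Rightarrow> clause set" where
  "subfragment F a b =
     {C \<in> F. (\<forall>A\<in>clause_atoms C. enat (arity (pred A)) \<le> a) \<and> enat (body_size C) \<le> b}"

text \<open>Reducibility of \<open>F\<close> to \<open>subfragment F \<infinity> b\<close>.\<close>

definition reducible :: "clause set \<Rightarrow> nat \<Rightarrow> bool" where
  "reducible F b \<longleftrightarrow> (\<forall>C\<in>F. b < body_size C \<longrightarrow>
     (\<exists>b'<body_size C. \<exists>C1\<in>subfragment F \<infinity> (enat b'). \<exists>C2\<in>subfragment F \<infinity> (enat b'). sld C1 C2 C))"

end

theory Submission
  imports Defs "HOL-Library.Infinite_Set"
begin

text \<open>Binary resolution is associative: if \<open>E\<close> is a resolvent of \<open>E1\<close> and \<open>E2\<close>, then resolving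
  \<open>D\<close> with \<open>E\<close> amounts to resolving \<open>D\<close> first with one of \<open>E1\<close>, \<open>E2\<close> and then with the other.
  Hence the clauses derivable by linear derivations are closed under resolution, and by induction on
  the body size a theory deriving all clauses of body size at most \<open>b\<close> derives all of \<open>F\<close>.
  Conversely, a resolvent of two clauses that are not facts is at least as long as each premise, so a
  derivation of a clause shorter than \<open>C\<close> never uses \<open>C\<close>. If \<open>C\<close> is longer than \<open>b\<close>, it is
  a resolvent of shorter clauses and is thus derivable without itself; a reduction core
  cannot contain it.\<close>

section \<open>Substitutions\<close>

lemma fst_comp_subst [simp]: "fst (comp_subst \<rho> \<sigma>) = fst \<rho> \<circ> fst \<sigma>"
  and snd_comp_subst [simp]: "snd (comp_subst \<rho> \<sigma>) = snd \<rho> \<circ> snd \<sigma>"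
  by (simp_all add: comp_subst_def)

lemma comp_subst_assoc: "comp_subst (comp_subst \<rho> \<sigma>) \<tau> = comp_subst \<rho> (comp_subst \<sigma> \<tau>)"
  by (simp add: comp_subst_def comp_assoc)

lemma is_subst_comp: "is_subst \<rho> \<Longrightarrow> is_subst \<sigma> \<Longrightarrow> is_subst (comp_subst \<rho> \<sigma>)"
  by (simp add: is_subst_def)

lemma subst_atom_comp: "subst_atom (comp_subst \<rho> \<sigma>) A = subst_atom \<rho> (subst_atom \<sigma> A)"
  by (simp add: subst_atom_def)

lemma subst_atom_cong:
  assumes "\<And>x. x \<in> set (args A) \<Longrightarrow> fst \<sigma> x = fst \<tau> x" "snd \<sigma> (pred A) = snd \<tau> (pred A)"
  shows "subst_atom \<sigma> A = subst_atom \<tau> A"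
  using assms by (simp add: subst_atom_def)

lemma subst_atom_cong_clause:
  assumes "\<And>x. x \<in> tvars C \<Longrightarrow> fst \<sigma> x = fst \<tau> x" "\<And>P. P \<in> pvars C \<Longrightarrow> snd \<sigma> P = snd \<tau> P"
    and "A \<in> clause_atoms C"
  shows "subst_atom \<sigma> A = subst_atom \<tau> A"
  using assms by (intro subst_atom_cong) (auto simp: tvars_def pvars_def)

lemma subst_clause_cong:
  assumes "\<And>x. x \<in> tvars C \<Longrightarrow> fst \<sigma> x = fst \<tau> x" "\<And>P. P \<in> pvars C \<Longrightarrow> snd \<sigma> P = snd \<tau> P"
  shows "subst_clause \<sigma> C = subst_clause \<tau> C"
proof -
  have "subst_atom \<sigma> A = subst_atom \<tau> A" if "A \<in> clause_atoms C" for A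
    using subst_atom_cong_clause[OF assms that] by blast
  then show ?thesis
    by (auto simp: subst_clause_def clause_atoms_def intro!: option.map_cong0 image_mset_cong)
qed

lemma clause_atoms_subst: "clause_atoms (subst_clause \<sigma> C) = subst_atom \<sigma> ` clause_atoms C"
  by (auto simp: clause_atoms_def subst_clause_def option.set_map)

lemma tvars_subst: "tvars (subst_clause \<sigma> C) = fst \<sigma> ` tvars C"
  by (auto simp: tvars_def clause_atoms_subst subst_atom_def)

lemma pvars_subst: "pvars (subst_clause \<sigma> C) = snd \<sigma> ` pvars C"
  by (auto simp: pvars_def clause_atoms_subst subst_atom_def image_image)

lemma finite_clause_atoms: "finite (clause_atoms C)"
  by (simp add: clause_atoms_def)

lemma finite_tvars: "finite (tvars C)"
  by (simp add: tvars_def finite_clause_atoms)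

lemma finite_pvars: "finite (pvars C)"
  by (simp add: pvars_def finite_clause_atoms)

section \<open>Extending finite injections to renamings\<close>

lemma finite_injection_extends_to_bij:
  fixes f :: "nat \<Rightarrow> nat"
  assumes "finite V" "inj_on f V"
  obtains g where "bij g" "\<And>x. x \<in> V \<Longrightarrow> g x = f x"
proof -
  have inf: "infinite (- V)" "infinite (- f ` V)"
    using assms(1) by (simp_all add: Compl_eq_Diff_UNIV)
  \<comment> \<open>Both complements are infinite sets of naturals, so listing each in increasing
    order matches them with one another.\<close>
  let ?h = "enumerate (- f ` V) \<circ> inv_into UNIV (enumerate (- V))"
  have "bij_betw ?h (- V) (- f ` V)"
    by (rule bij_betw_trans[OF bij_betw_inv_into[OF bij_enumerate[OF inf(1)]] bij_enumerate[OF inf(2)]])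
  moreover have "bij_betw f V (f ` V)"
    using assms(2) by (simp add: bij_betw_def)
  ultimately have "bij_betw (\<lambda>x. if x \<in> V then f x else ?h x) (V \<union> - V) (f ` V \<union> - f ` V)"
    by (intro bij_betw_disjoint_Un) (simp_all del: o_apply)
  then show thesis
    by (intro that[of "\<lambda>x. if x \<in> V then f x else ?h x"]) simp_all
qed

text \<open>Renamings are global bijections, but only their values on the finitely many variables of
  a clause matter. This lets a merely injective substitution pass for a renaming.\<close>

lemma finite_injection_extends_to_renaming:
  assumes "finite V" "finite W" "inj_on (fst \<sigma>) V" "inj_on (snd \<sigma>) W" "is_subst \<sigma>"
  obtains r where "is_renaming r" "\<And>x. x \<in> V \<Longrightarrow> fst r x = fst \<sigma> x"
    "\<And>P. P \<in> W \<Longrightarrow> snd r P = snd \<sigma> P"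
proof -
  obtain g where g: "bij g" "\<And>x. x \<in> V \<Longrightarrow> g x = fst \<sigma> x"
    using finite_injection_extends_to_bij[OF assms(1,3)] by blast
  have ar: "arity (snd \<sigma> P) = arity P" for P
    using assms(5) by (simp add: is_subst_def)
  \<comment> \<open>Arities must be preserved, so the extension is made separately for each arity
    \<open>a\<close>, where a predicate variable is just its index.\<close>
  have "\<exists>h. bij h \<and> (\<forall>i. PVar i a \<in> W \<longrightarrow> h i = pindex (snd \<sigma> (PVar i a)))" for a
  proof -
    have "finite {i. PVar i a \<in> W}"
      using finite_vimageI[OF assms(2), of "\<lambda>i. PVar i a"] by (auto simp: vimage_def inj_def)
    moreover have "inj_on (\<lambda>i. pindex (snd \<sigma> (PVar i a))) {i. PVar i a \<in> W}"
    proof (rule inj_onI)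
      fix i j
      assume ij: "i \<in> {i. PVar i a \<in> W}" "j \<in> {i. PVar i a \<in> W}"
        and "pindex (snd \<sigma> (PVar i a)) = pindex (snd \<sigma> (PVar j a))"
      then have "snd \<sigma> (PVar i a) = snd \<sigma> (PVar j a)" by (simp add: pvar.expand ar)
      then show "i = j" using inj_onD[OF assms(4)] ij by blast
    qed
    ultimately obtain h where "bij h" "\<And>i. i \<in> {i. PVar i a \<in> W} \<Longrightarrow> h i = pindex (snd \<sigma> (PVar i a))"
      by (rule finite_injection_extends_to_bij) blast
    then show ?thesis by blast
  qed
  then obtain h where h: "\<And>a. bij (h a)"
    "\<And>a i. PVar i a \<in> W \<Longrightarrow> h a i = pindex (snd \<sigma> (PVar i a))" by metis
  define k where "k = (\<lambda>P. PVar (h (arity P) (pindex P)) (arity P))"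
  have "bij k"
    unfolding k_def
  proof (rule o_bij)
    show "(\<lambda>P. PVar (inv (h (arity P)) (pindex P)) (arity P)) \<circ>
        (\<lambda>P. PVar (h (arity P) (pindex P)) (arity P)) = id"
      using h(1) by (auto simp: fun_eq_iff bij_is_inj)
    show "(\<lambda>P. PVar (h (arity P) (pindex P)) (arity P)) \<circ>
        (\<lambda>P. PVar (inv (h (arity P)) (pindex P)) (arity P)) = id"
      using h(1) by (auto simp: fun_eq_iff bij_is_surj surj_f_inv_f)
  qed
  moreover have "k P = snd \<sigma> P" if "P \<in> W" for P
    using h(2)[of "pindex P" "arity P"] that ar[of P] by (auto simp: k_def intro: pvar.expand)
  ultimately show thesis
    using g by (intro that[of "(g, k)"]) (auto simp: is_renaming_def is_subst_def k_def)
qed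

lemma renaming_inverse:
  assumes "is_renaming r"
  obtains r' where "is_subst r'" "comp_subst r' r = (id, id)" "comp_subst r r' = (id, id)"
proof
  have b: "bij (fst r)" "bij (snd r)" and ar: "\<And>P. arity (snd r P) = arity P"
    using assms by (auto simp: is_renaming_def is_subst_def)
  let ?r = "(inv (fst r), inv (snd r))"
  show "is_subst ?r"
    using ar b(2) by (simp add: is_subst_def) (metis bij_is_surj surj_f_inv_f)
  show "comp_subst ?r r = (id, id)" "comp_subst r ?r = (id, id)"
    using b by (auto simp: comp_subst_def fun_eq_iff bij_is_inj bij_is_surj surj_f_inv_f)
qed

lemma comp_subst_id [simp]: "comp_subst \<sigma> (id, id) = \<sigma>" "comp_subst (id, id) \<sigma> = \<sigma>"
  by (simp_all add: comp_subst_def)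


section \<open>Most general pairs\<close>

text \<open>Unifying by two substitutions, one for each atom, replaces renaming apart: a most general pair
  is a most general unifier of the copies of \<open>A\<close> and \<open>B\<close> over the even and the odd variables.\<close>

definition mg_pair :: "subst \<Rightarrow> subst \<Rightarrow> atom \<Rightarrow> atom \<Rightarrow> bool" where
  "mg_pair \<alpha> \<beta> A B \<longleftrightarrow> is_subst \<alpha> \<and> is_subst \<beta> \<and> subst_atom \<alpha> A = subst_atom \<beta> B \<and>
     (\<forall>\<alpha>' \<beta>'. is_subst \<alpha>' \<longrightarrow> is_subst \<beta>' \<longrightarrow> subst_atom \<alpha>' A = subst_atom \<beta>' B \<longrightarrow>
        (\<exists>\<rho>. is_subst \<rho> \<and> \<alpha>' = comp_subst \<rho> \<alpha> \<and> \<beta>' = comp_subst \<rho> \<beta>))"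

definition to_even :: subst where
  "to_even = (\<lambda>x. 2 * x, \<lambda>P. PVar (2 * pindex P) (arity P))"

definition to_odd :: subst where
  "to_odd = (\<lambda>x. 2 * x + 1, \<lambda>P. PVar (2 * pindex P + 1) (arity P))"

text \<open>The even and the odd variables partition all variables, so \<open>to_even\<close> and
  \<open>to_odd\<close> are the injections of a coproduct and this is the induced map out of
  it.\<close>

definition copair :: "subst \<Rightarrow> subst \<Rightarrow> subst" where
  "copair \<alpha> \<beta> =
     (\<lambda>x. fst (if even x then \<alpha> else \<beta>) (x div 2),
      \<lambda>P. snd (if even (pindex P) then \<alpha> else \<beta>) (PVar (pindex P div 2) (arity P)))"

lemma is_subst_to_even: "is_subst to_even" and is_subst_to_odd: "is_subst to_odd"
  by (simp_all add: is_subst_def to_even_def to_odd_def)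

lemma inj_to_even: "inj (fst to_even)" "inj (snd to_even)"
  and inj_to_odd: "inj (fst to_odd)" "inj (snd to_odd)"
  by (auto simp: inj_def to_even_def to_odd_def pvar.expand)

lemma to_even_neq_to_odd: "fst to_even x \<noteq> fst to_odd y" "snd to_even P \<noteq> snd to_odd Q"
  by (simp_all add: to_even_def to_odd_def) presburger+

lemma is_subst_copair: "is_subst \<alpha> \<Longrightarrow> is_subst \<beta> \<Longrightarrow> is_subst (copair \<alpha> \<beta>)"
  by (simp add: is_subst_def copair_def)

lemma copair_to_even [simp]: "comp_subst (copair \<alpha> \<beta>) to_even = \<alpha>"
  by (simp add: comp_subst_def copair_def to_even_def comp_def)

lemma copair_to_odd [simp]: "comp_subst (copair \<alpha> \<beta>) to_odd = \<beta>"
  by (simp add: comp_subst_def copair_def to_odd_def comp_def)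

text \<open>The uniqueness half of the coproduct property: a substitution is determined by its
  restrictions to the two copies.\<close>

lemma copair_eta: "copair (comp_subst \<sigma> to_even) (comp_subst \<sigma> to_odd) = \<sigma>"
  by (rule prod_eqI) (auto simp: copair_def to_even_def to_odd_def fun_eq_iff)

lemma subst_even_odd_eqI:
  assumes "comp_subst \<sigma> to_even = comp_subst \<tau> to_even" "comp_subst \<sigma> to_odd = comp_subst \<tau> to_odd"
  shows "\<sigma> = \<tau>"
  using assms by (metis copair_eta)

lemma mg_pair_sym: "mg_pair \<alpha> \<beta> A B \<Longrightarrow> mg_pair \<beta> \<alpha> B A"
proof -
  assume m: "mg_pair \<alpha> \<beta> A B"
  have "\<exists>\<rho>. is_subst \<rho> \<and> \<beta>' = comp_subst \<rho> \<beta> \<and> \<alpha>' = comp_subst \<rho> \<alpha>"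
    if "is_subst \<beta>'" "is_subst \<alpha>'" "subst_atom \<beta>' B = subst_atom \<alpha>' A" for \<alpha>' \<beta>'
  proof -
    have "\<exists>\<rho>. is_subst \<rho> \<and> \<alpha>' = comp_subst \<rho> \<alpha> \<and> \<beta>' = comp_subst \<rho> \<beta>"
      using m that(1,2) that(3)[symmetric] unfolding mg_pair_def by blast
    then show ?thesis by blast
  qed
  with m show "mg_pair \<beta> \<alpha> B A" by (simp add: mg_pair_def)
qed

text \<open>By the coproduct property, unifiers of the two copies correspond to pairs of
  substitutions identifying \<open>A\<close> and \<open>B\<close>, and factorizations correspond as
  well.\<close>

lemma mg_pair_of_mgu:
  assumes "is_mgu \<sigma> (subst_atom to_even A) (subst_atom to_odd B)"
  shows "mg_pair (comp_subst \<sigma> to_even) (comp_subst \<sigma> to_odd) A B"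
  unfolding mg_pair_def
proof (intro conjI allI impI)
  have s: "is_subst \<sigma>" using assms by (simp add: is_mgu_def is_unifier_def)
  show "is_subst (comp_subst \<sigma> to_even)" "is_subst (comp_subst \<sigma> to_odd)"
    by (simp_all add: s is_subst_comp is_subst_to_even is_subst_to_odd)
  show "subst_atom (comp_subst \<sigma> to_even) A = subst_atom (comp_subst \<sigma> to_odd) B"
    using assms by (simp add: is_mgu_def is_unifier_def subst_atom_comp)
  fix \<alpha> \<beta> assume ab: "is_subst \<alpha>" "is_subst \<beta>" "subst_atom \<alpha> A = subst_atom \<beta> B"
  then have "is_unifier (copair \<alpha> \<beta>) (subst_atom to_even A) (subst_atom to_odd B)"
    by (simp add: is_unifier_def is_subst_copair flip: subst_atom_comp)
  then obtain \<rho> where "is_subst \<rho>" "copair \<alpha> \<beta> = comp_subst \<rho> \<sigma>"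
    using assms unfolding is_mgu_def by blast
  then show "\<exists>\<rho>. is_subst \<rho> \<and> \<alpha> = comp_subst \<rho> (comp_subst \<sigma> to_even) \<and>
      \<beta> = comp_subst \<rho> (comp_subst \<sigma> to_odd)"
    by (metis comp_subst_assoc copair_to_even copair_to_odd)
qed

lemma mgu_of_mg_pair:
  assumes "mg_pair \<alpha> \<beta> A B"
  shows "is_mgu (copair \<alpha> \<beta>) (subst_atom to_even A) (subst_atom to_odd B)"
  unfolding is_mgu_def
proof (intro conjI allI impI)
  show "is_unifier (copair \<alpha> \<beta>) (subst_atom to_even A) (subst_atom to_odd B)"
    using assms by (simp add: is_unifier_def is_subst_copair mg_pair_def flip: subst_atom_comp)
  fix \<tau> assume "is_unifier \<tau> (subst_atom to_even A) (subst_atom to_odd B)"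
  then have "is_subst (comp_subst \<tau> to_even)" "is_subst (comp_subst \<tau> to_odd)"
    "subst_atom (comp_subst \<tau> to_even) A = subst_atom (comp_subst \<tau> to_odd) B"
    by (simp_all add: is_unifier_def subst_atom_comp is_subst_comp is_subst_to_even is_subst_to_odd)
  then obtain \<rho> where \<rho>: "is_subst \<rho>" "comp_subst \<tau> to_even = comp_subst \<rho> \<alpha>"
    "comp_subst \<tau> to_odd = comp_subst \<rho> \<beta>"
    using assms unfolding mg_pair_def by blast
  have "\<tau> = comp_subst \<rho> (copair \<alpha> \<beta>)"
    by (rule subst_even_odd_eqI) (simp_all add: \<rho> comp_subst_assoc)
  with \<rho>(1) show "\<exists>\<rho>. is_subst \<rho> \<and> \<tau> = comp_subst \<rho> (copair \<alpha> \<beta>)" by blast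
qed


section \<open>Existence of surjective most general unifiers\<close>

text \<open>The map \<open>f\<close> is the quotient by the joint kernel of \<open>U\<close>.
  Outside the finite set \<open>V\<close> every class is a singleton, so there are infinitely many
  classes and they can be renumbered by all naturals.\<close>

lemma surj_joint_kernel:
  fixes U :: "(nat \<Rightarrow> 'a) set"
  assumes "finite V" and sep: "\<And>x y. x \<notin> V \<Longrightarrow> y \<noteq> x \<Longrightarrow> \<exists>u\<in>U. u x \<noteq> u y"
  obtains f :: "nat \<Rightarrow> nat" where "surj f" "\<And>x y. f x = f y \<longleftrightarrow> (\<forall>u\<in>U. u x = u y)"
proof -
  define rep where "rep x = (LEAST y. \<forall>u\<in>U. u y = u x)" for x
  have rep: "\<forall>u\<in>U. u (rep x) = u x" for x
    unfolding rep_def by (rule LeastI[of _ x]) simp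
  have rep_eq: "rep x = rep y \<longleftrightarrow> (\<forall>u\<in>U. u x = u y)" for x y
  proof
    show "rep x = rep y \<Longrightarrow> \<forall>u\<in>U. u x = u y" using rep by metis
    show "\<forall>u\<in>U. u x = u y \<Longrightarrow> rep x = rep y" unfolding rep_def by (metis (no_types))
  qed
  have "rep x = x" if "x \<notin> V" for x
    using sep[OF that, of "rep x"] rep[of x] by fastforce
  then have "- V \<subseteq> range rep" by (metis ComplD rangeI subsetI)
  moreover have "infinite (- V)" using assms(1) by (simp add: Compl_eq_Diff_UNIV)
  ultimately have inf: "infinite (range rep)" using finite_subset by blast
  let ?g = "inv_into UNIV (enumerate (range rep))"
  have g: "bij_betw ?g (range rep) UNIV"
    by (rule bij_betw_inv_into[OF bij_enumerate[OF inf]])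
  show thesis
  proof (rule that[of "?g \<circ> rep"])
    show "surj (?g \<circ> rep)" using g unfolding bij_betw_def by (metis image_comp)
    show "(?g \<circ> rep) x = (?g \<circ> rep) y \<longleftrightarrow> (\<forall>u\<in>U. u x = u y)" for x y
      using inj_on_eq_iff[OF bij_betw_imp_inj_on[OF g], of "rep x" "rep y"]
      by (simp only: rangeI rep_eq comp_apply)
  qed
qed

text \<open>No unification algorithm is run: two variables are identified exactly when every unifier
  identifies them. Every unifier then factors through this quotient, and the quotient is itself a
  unifier.\<close>

lemma ex_surj_mgu:
  assumes \<tau>0: "is_unifier \<tau>0 A B"
  obtains \<sigma> where "is_mgu \<sigma> A B" "surj (fst \<sigma>)" "surj (snd \<sigma>)"
proof -
  let ?U = "{\<tau>. is_unifier \<tau> A B}"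
  have ar: "arity (snd \<tau> P) = arity P" if "is_unifier \<tau> A B" for \<tau> P
    using that by (simp add: is_unifier_def is_subst_def)
  have "\<exists>u\<in>fst ` ?U. u x \<noteq> u y" if "x \<notin> set (args A) \<union> set (args B)" "y \<noteq> x" for x y
  proof -
    \<comment> \<open>Since \<open>x\<close> occurs in neither atom, changing \<tau>0 at
      \<open>x\<close> leaves a unifier; \<open>Suc\<close> makes its value at \<open>x\<close>
      differ from the one at \<open>y\<close>.\<close>
    let ?\<tau> = "((fst \<tau>0)(x := Suc (fst \<tau>0 y)), snd \<tau>0)"
    have "subst_atom ?\<tau> A = subst_atom \<tau>0 A" "subst_atom ?\<tau> B = subst_atom \<tau>0 B"
      by (rule subst_atom_cong; use that in auto)+
    with \<tau>0 have "is_unifier ?\<tau> A B" by (simp add: is_unifier_def is_subst_def)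
    moreover have "fst ?\<tau> x \<noteq> fst ?\<tau> y" using that by simp
    ultimately show ?thesis by blast
  qed
  then obtain f :: "nat \<Rightarrow> nat" where f: "surj f" "\<And>x y. f x = f y \<longleftrightarrow> (\<forall>u\<in>fst ` ?U. u x = u y)"
    by (rule surj_joint_kernel[of "set (args A) \<union> set (args B)" "fst ` ?U", rotated]) auto
  \<comment> \<open>Predicate variables are handled one arity at a time, so that the quotient map
    keeps arities.\<close>
  have "\<exists>g :: nat \<Rightarrow> nat. surj g \<and>
      (\<forall>i j. g i = g j \<longleftrightarrow> (\<forall>\<tau>\<in>?U. snd \<tau> (PVar i a) = snd \<tau> (PVar j a)))" for a
  proof -
    let ?V = "{pindex (pred A), pindex (pred B)}" and ?W = "(\<lambda>\<tau> i. snd \<tau> (PVar i a)) ` ?U"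
    have "\<exists>u\<in>?W. u i \<noteq> u j" if "i \<notin> ?V" "j \<noteq> i" for i j
    proof -
      let ?\<tau> = "(fst \<tau>0, (snd \<tau>0)(PVar i a := PVar (Suc (pindex (snd \<tau>0 (PVar j a)))) a))"
      have "subst_atom ?\<tau> A = subst_atom \<tau>0 A" "subst_atom ?\<tau> B = subst_atom \<tau>0 B"
        by (rule subst_atom_cong; use that in auto)+
      with \<tau>0 have "is_unifier ?\<tau> A B" by (simp add: is_unifier_def is_subst_def)
      moreover have "snd ?\<tau> (PVar i a) \<noteq> snd ?\<tau> (PVar j a)"
        using that by simp (metis n_not_Suc_n pvar.sel(1))
      ultimately show ?thesis by (intro bexI[OF _ imageI[of ?\<tau>]]) simp_all
    qed
    then obtain g :: "nat \<Rightarrow> nat" where "surj g" "\<And>i j. g i = g j \<longleftrightarrow> (\<forall>u\<in>?W. u i = u j)"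
      by (rule surj_joint_kernel[of ?V ?W, rotated]) auto
    then have "surj g \<and> (\<forall>i j. g i = g j \<longleftrightarrow> (\<forall>\<tau>\<in>?U. snd \<tau> (PVar i a) = snd \<tau> (PVar j a)))"
      by (simp only: ball_simps) simp
    then show ?thesis by (rule exI[of _ g])
  qed
  then obtain g :: "nat \<Rightarrow> nat \<Rightarrow> nat" where g: "\<And>a. surj (g a)"
    "\<And>a i j. g a i = g a j \<longleftrightarrow> (\<forall>\<tau>\<in>?U. snd \<tau> (PVar i a) = snd \<tau> (PVar j a))"
    by metis
  define h where "h P = PVar (g (arity P) (pindex P)) (arity P)" for P
  have h_eq: "h P = h Q \<longleftrightarrow> (\<forall>\<tau>\<in>?U. snd \<tau> P = snd \<tau> Q)" for P Q
  proof (cases "arity P = arity Q")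
    case True
    then show ?thesis by (simp add: h_def g) (metis pvar.collapse)
  next
    case False
    \<comment> \<open>Different arities are never identified; the given unifier \<tau>0 witnesses
      that the right-hand side fails too.\<close>
    then have "h P \<noteq> h Q" "snd \<tau>0 P \<noteq> snd \<tau>0 Q"
      using ar[OF \<tau>0, of P] ar[OF \<tau>0, of Q] by (auto simp: h_def)
    then show ?thesis using \<tau>0 by blast
  qed
  have surj_h: "surj h"
  proof (rule surjI)
    show "h (PVar (inv (g (arity P)) (pindex P)) (arity P)) = P" for P
      by (simp add: h_def surj_f_inv_f[OF g(1)])
  qed
  have "is_mgu (f, h) A B"
    unfolding is_mgu_def
  proof (intro conjI allI impI)
    have len: "length (args A) = length (args B)"
      using \<tau>0 by (auto simp: is_unifier_def subst_atom_def dest: map_eq_imp_length_eq)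
    have "h (pred A) = h (pred B)"
      by (auto simp: h_eq is_unifier_def subst_atom_def)
    moreover have "map f (args A) = map f (args B)"
    proof (rule nth_equalityI)
      fix i assume i: "i < length (map f (args A))"
      have "fst \<tau> (args A ! i) = fst \<tau> (args B ! i)" if "is_unifier \<tau> A B" for \<tau>
      proof -
        have "map (fst \<tau>) (args A) = map (fst \<tau>) (args B)"
          using that by (simp add: is_unifier_def subst_atom_def)
        then show ?thesis using i len by (metis length_map nth_map)
      qed
      then show "map f (args A) ! i = map f (args B) ! i" using i len by (simp add: f(2))
    qed (simp add: len)
    moreover have "is_subst (f, h)" by (simp add: is_subst_def h_def)
    ultimately show "is_unifier (f, h) A B" by (simp add: is_unifier_def subst_atom_def)
    fix \<tau> assume \<tau>: "is_unifier \<tau> A B"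
    \<comment> \<open>The factor picks any preimage under the quotient map; the choice is harmless
      because \<tau> is constant on each fibre.\<close>
    let ?\<rho> = "(fst \<tau> \<circ> inv f, snd \<tau> \<circ> inv h)"
    have "fst \<tau> (inv f (f x)) = fst \<tau> x" for x
      using f(2)[of "inv f (f x)" x] \<tau> surj_f_inv_f[OF f(1)] by blast
    moreover have *: "snd \<tau> (inv h (h P)) = snd \<tau> P" for P
      using h_eq[of "inv h (h P)" P] \<tau> surj_f_inv_f[OF surj_h] by blast
    ultimately have "\<tau> = comp_subst ?\<rho> (f, h)"
      by (intro prod_eqI) (simp_all add: fun_eq_iff)
    moreover have "arity (inv h P) = arity P" for P
      using arg_cong[OF surj_f_inv_f[OF surj_h, of P], of arity] by (simp add: h_def)
    then have "is_subst ?\<rho>" using ar[OF \<tau>] by (simp add: is_subst_def)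
    ultimately show "\<exists>\<rho>. is_subst \<rho> \<and> \<tau> = comp_subst \<rho> (f, h)" by blast
  qed
  with f(1) surj_h show thesis by (intro that[of "(f, h)"]) simp_all
qed

text \<open>Surjectivity makes the pair jointly epic, i.e. the factoring substitution is unique on all
  variables, not only on those in the range.\<close>

lemma ex_epic_mg_pair:
  assumes "is_subst \<alpha>" "is_subst \<beta>" "subst_atom \<alpha> A = subst_atom \<beta> B"
  obtains \<alpha>1 \<beta>1 where "mg_pair \<alpha>1 \<beta>1 A B"
    "\<And>\<rho> \<rho>'. comp_subst \<rho> \<alpha>1 = comp_subst \<rho>' \<alpha>1 \<Longrightarrow> comp_subst \<rho> \<beta>1 = comp_subst \<rho>' \<beta>1 \<Longrightarrow> \<rho> = \<rho>'"
proof -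
  have "is_unifier (copair \<alpha> \<beta>) (subst_atom to_even A) (subst_atom to_odd B)"
    using assms by (simp add: is_unifier_def is_subst_copair flip: subst_atom_comp)
  then obtain \<sigma> where \<sigma>: "is_mgu \<sigma> (subst_atom to_even A) (subst_atom to_odd B)"
    "surj (fst \<sigma>)" "surj (snd \<sigma>)"
    by (rule ex_surj_mgu)
  show thesis
  proof (rule that[OF mg_pair_of_mgu[OF \<sigma>(1)]])
    fix \<rho> \<rho>'
    assume "comp_subst \<rho> (comp_subst \<sigma> to_even) = comp_subst \<rho>' (comp_subst \<sigma> to_even)"
      "comp_subst \<rho> (comp_subst \<sigma> to_odd) = comp_subst \<rho>' (comp_subst \<sigma> to_odd)"
    then have "comp_subst \<rho> \<sigma> = comp_subst \<rho>' \<sigma>"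
      unfolding comp_subst_assoc[symmetric] by (rule subst_even_odd_eqI)
    then have "fst \<rho> \<circ> fst \<sigma> = fst \<rho>' \<circ> fst \<sigma>" "snd \<rho> \<circ> snd \<sigma> = snd \<rho>' \<circ> snd \<sigma>"
      by (simp_all add: comp_subst_def)
    then show "\<rho> = \<rho>'"
      using \<sigma>(2,3) by (metis prod_eqI surj_fun_eq)
  qed
qed

text \<open>Two successive unifications can be performed in the opposite order.\<close>

lemma mg_pair_exchange:
  assumes 1: "mg_pair \<alpha> \<beta> A1 B1" and 2: "mg_pair \<gamma> \<delta> A (subst_atom \<alpha> B)"
  obtains \<gamma>1 \<alpha>1 \<kappa> where "mg_pair \<gamma>1 \<alpha>1 A B"
    "mg_pair \<kappa> (comp_subst \<delta> \<beta>) (subst_atom \<alpha>1 A1) B1"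
    "\<gamma> = comp_subst \<kappa> \<gamma>1" "comp_subst \<delta> \<alpha> = comp_subst \<kappa> \<alpha>1"
proof -
  have s: "is_subst \<alpha>" "is_subst \<beta>" "is_subst \<gamma>" "is_subst \<delta>"
    and e1: "subst_atom \<alpha> A1 = subst_atom \<beta> B1"
    and e2: "subst_atom \<gamma> A = subst_atom (comp_subst \<delta> \<alpha>) B"
    using 1 2 by (auto simp: mg_pair_def subst_atom_comp)
  \<comment> \<open>By \<open>e2\<close>, the composed substitutions already unify \<open>A\<close>
    with \<open>B\<close> directly. The jointly epic version is taken because the factorization
    below has to be compared on all variables.\<close>
  obtain \<gamma>1 \<alpha>1 where m: "mg_pair \<gamma>1 \<alpha>1 A B"
    and epic: "\<And>\<rho> \<rho>'. comp_subst \<rho> \<gamma>1 = comp_subst \<rho>' \<gamma>1 \<Longrightarrow>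
      comp_subst \<rho> \<alpha>1 = comp_subst \<rho>' \<alpha>1 \<Longrightarrow> \<rho> = \<rho>'"
    using ex_epic_mg_pair[OF s(3) is_subst_comp[OF s(4,1)] e2] by blast
  have sm: "is_subst \<gamma>1" "is_subst \<alpha>1" "subst_atom \<gamma>1 A = subst_atom \<alpha>1 B"
    using m by (auto simp: mg_pair_def)
  obtain \<kappa> where \<kappa>: "is_subst \<kappa>" "\<gamma> = comp_subst \<kappa> \<gamma>1" "comp_subst \<delta> \<alpha> = comp_subst \<kappa> \<alpha>1"
    using m s(3) is_subst_comp[OF s(4,1)] e2 unfolding mg_pair_def by blast
  have "mg_pair \<kappa> (comp_subst \<delta> \<beta>) (subst_atom \<alpha>1 A1) B1"
    unfolding mg_pair_def
  proof (intro conjI allI impI)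
    show "is_subst \<kappa>" "is_subst (comp_subst \<delta> \<beta>)" using \<kappa> s is_subst_comp by auto
    show "subst_atom \<kappa> (subst_atom \<alpha>1 A1) = subst_atom (comp_subst \<delta> \<beta>) B1"
      using e1 \<kappa>(3) by (metis subst_atom_comp)
    fix \<kappa>' \<epsilon>
    assume a: "is_subst \<kappa>'" "is_subst \<epsilon>" "subst_atom \<kappa>' (subst_atom \<alpha>1 A1) = subst_atom \<epsilon> B1"
    then have "subst_atom (comp_subst \<kappa>' \<alpha>1) A1 = subst_atom \<epsilon> B1" by (simp add: subst_atom_comp)
    \<comment> \<open>A competing pair is factored in the original order: first through \<alpha> and
      \<beta>, giving \<pi>, then through \<gamma> and \<delta>, giving \<rho>.\<close>
    then obtain \<pi> where \<pi>: "is_subst \<pi>" "comp_subst \<kappa>' \<alpha>1 = comp_subst \<pi> \<alpha>" "\<epsilon> = comp_subst \<pi> \<beta>"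
      using 1 a is_subst_comp[OF a(1) sm(2)] unfolding mg_pair_def by blast
    have "subst_atom (comp_subst \<kappa>' \<gamma>1) A = subst_atom \<pi> (subst_atom \<alpha> B)"
      using sm(3) \<pi>(2) by (metis subst_atom_comp)
    then obtain \<rho> where \<rho>: "is_subst \<rho>" "comp_subst \<kappa>' \<gamma>1 = comp_subst \<rho> \<gamma>" "\<pi> = comp_subst \<rho> \<delta>"
      using 2 \<pi>(1) is_subst_comp[OF a(1) sm(1)] unfolding mg_pair_def by blast
    \<comment> \<open>Both sides agree after composition with \<gamma>1 and with \<alpha>1, so joint
      epicness makes them equal.\<close>
    have "\<kappa>' = comp_subst \<rho> \<kappa>"
      by (rule epic) (simp_all add: \<rho>(2) \<pi>(2) \<rho>(3) \<kappa>(2) comp_subst_assoc flip: \<kappa>(3))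
    moreover have "\<epsilon> = comp_subst \<rho> (comp_subst \<delta> \<beta>)"
      by (simp add: \<pi>(3) \<rho>(3) comp_subst_assoc)
    ultimately show "\<exists>\<rho>. is_subst \<rho> \<and> \<kappa>' = comp_subst \<rho> \<kappa> \<and> \<epsilon> = comp_subst \<rho> (comp_subst \<delta> \<beta>)"
      using \<rho>(1) by blast
  qed
  then show thesis by (rule that[OF m _ \<kappa>(2,3)])
qed


section \<open>Associativity of resolution\<close>

text \<open>Each premise has its own substitution, so nothing is renamed apart. The relation is
  directed: the first premise supplies the body literal.\<close>

definition resolvent :: "clause \<Rightarrow> clause \<Rightarrow> clause \<Rightarrow> bool" where
  "resolvent D E C \<longleftrightarrow> (\<exists>A B \<alpha> \<beta>. A \<in># body D \<and> head E = Some B \<and> mg_pair \<alpha> \<beta> A B \<and>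
     C = Clause (map_option (subst_atom \<alpha>) (head D))
           (image_mset (subst_atom \<alpha>) (body D - {#A#}) + image_mset (subst_atom \<beta>) (body E)))"

section \<open>Resolution with and without renaming apart\<close>

lemma variant_copy:
  assumes "is_subst \<sigma>" "inj (fst \<sigma>)" "inj (snd \<sigma>)"
  shows "is_variant (subst_clause \<sigma> C) C"
proof -
  \<comment> \<open>A substitution such as \<open>to_even\<close> is not surjective and hence no
    renaming, but it agrees with one on the variables of \<open>C\<close>.\<close>
  obtain r where "is_renaming r" "\<And>x. x \<in> tvars C \<Longrightarrow> fst r x = fst \<sigma> x"
    "\<And>P. P \<in> pvars C \<Longrightarrow> snd r P = snd \<sigma> P"
    using finite_injection_extends_to_renaming[OF finite_tvars finite_pvars, of \<sigma> C C] assms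
    by (metis inj_on_subset subset_UNIV)
  then show ?thesis unfolding is_variant_def by (metis subst_clause_cong)
qed

lemma resolves_variants_of_resolvent:
  assumes "resolvent D E C"
  obtains D1 E1 where "is_variant D1 D" "is_variant E1 E" "tvars D1 \<inter> tvars E1 = {}"
    "pvars D1 \<inter> pvars E1 = {}" "resolves_body_head D1 E1 C"
proof -
  obtain A B \<alpha> \<beta> where A: "A \<in># body D" and B: "head E = Some B" and m: "mg_pair \<alpha> \<beta> A B"
    and C: "C = Clause (map_option (subst_atom \<alpha>) (head D))
           (image_mset (subst_atom \<alpha>) (body D - {#A#}) + image_mset (subst_atom \<beta>) (body E))"
    using assms by (auto simp: resolvent_def)
  have at: "subst_atom (copair \<alpha> \<beta>) (subst_atom to_even X) = subst_atom \<alpha> X"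
    "subst_atom (copair \<alpha> \<beta>) (subst_atom to_odd X) = subst_atom \<beta> X" for X
    by (simp_all flip: subst_atom_comp)
  show thesis
  proof (rule that[of "subst_clause to_even D" "subst_clause to_odd E"])
    show "is_variant (subst_clause to_even D) D" "is_variant (subst_clause to_odd E) E"
      by (simp_all add: variant_copy is_subst_to_even is_subst_to_odd inj_to_even inj_to_odd)
    show "tvars (subst_clause to_even D) \<inter> tvars (subst_clause to_odd E) = {}"
      by (auto simp: tvars_subst to_even_neq_to_odd)
    show "pvars (subst_clause to_even D) \<inter> pvars (subst_clause to_odd E) = {}"
      by (auto simp: pvars_subst to_even_neq_to_odd)
    show "resolves_body_head (subst_clause to_even D) (subst_clause to_odd E) C"
      unfolding resolves_body_head_def
    proof (rule exI[of _ "subst_atom to_even A"], rule exI[of _ "subst_atom to_odd B"],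
        rule exI[of _ "copair \<alpha> \<beta>"], intro conjI mgu_of_mg_pair[OF m])
      show "subst_atom to_even A \<in># body (subst_clause to_even D)"
        "head (subst_clause to_odd E) = Some (subst_atom to_odd B)"
        using A B by (simp_all add: subst_clause_def)
      \<comment> \<open>Deleting one occurrence commutes with the image because \<open>A\<close>
        does occur in the body.\<close>
      have "body (subst_clause to_even D) - {#subst_atom to_even A#} =
          image_mset (subst_atom to_even) (body D - {#A#})"
        using A by (simp add: subst_clause_def image_mset_Diff)
      then show "C = subst_clause (copair \<alpha> \<beta>) (Clause (head (subst_clause to_even D))
          (body (subst_clause to_even D) - {#subst_atom to_even A#} + body (subst_clause to_odd E)))"
        by (simp add: C subst_clause_def option.map_comp comp_def multiset.map_comp at)
    qed
  qed
qed

lemma is_mgu_renaming: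
  assumes "is_mgu \<sigma> A B" "is_subst t" "is_subst t'" "comp_subst t' t = (id, id)"
    "comp_subst t t' = (id, id)"
  shows "is_mgu (comp_subst \<sigma> t') (subst_atom t A) (subst_atom t B)"
  unfolding is_mgu_def
proof (intro conjI allI impI)
  have "subst_atom (comp_subst \<sigma> t') (subst_atom t X) = subst_atom \<sigma> X" for X
    using assms(4) by (simp add: comp_subst_assoc flip: subst_atom_comp)
  with assms show "is_unifier (comp_subst \<sigma> t') (subst_atom t A) (subst_atom t B)"
    by (simp add: is_mgu_def is_unifier_def is_subst_comp)
  fix \<tau> assume "is_unifier \<tau> (subst_atom t A) (subst_atom t B)"
  then have "is_unifier (comp_subst \<tau> t) A B"
    using assms(2) by (simp add: is_unifier_def is_subst_comp subst_atom_comp)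
  then obtain \<rho> where "is_subst \<rho>" "comp_subst \<tau> t = comp_subst \<rho> \<sigma>"
    using assms(1) unfolding is_mgu_def by blast
  then show "\<exists>\<rho>. is_subst \<rho> \<and> \<tau> = comp_subst \<rho> (comp_subst \<sigma> t')"
    using assms(5) by (metis comp_subst_assoc comp_subst_id(1))
qed

lemma inj_on_case:
  assumes "inj_on f V" "inj_on g W" "f ` V \<inter> g ` W = {}"
  shows "inj_on (\<lambda>x. if x \<in> V then f x else g x) (V \<union> W)"
proof (rule inj_onI)
  fix x y
  assume xy: "x \<in> V \<union> W" "y \<in> V \<union> W"
    and eq: "(if x \<in> V then f x else g x) = (if y \<in> V then f y else g y)"
  have "x \<in> V \<longleftrightarrow> y \<in> V"
    using xy eq assms(3) by (fastforce split: if_splits)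
  then show "x = y"
    using xy eq inj_onD[OF assms(1), of x y] inj_onD[OF assms(2), of x y] by auto
qed

text \<open>Any two variants with disjoint variables can be carried simultaneously, by a single
  renaming \<open>t\<close>, to the even and the odd copy, where \<open>mg_pair_of_mgu\<close>
  applies.\<close>

lemma resolvent_of_resolves_variants:
  assumes "is_variant D1 D" "is_variant E1 E" and disj: "tvars D1 \<inter> tvars E1 = {}"
    "pvars D1 \<inter> pvars E1 = {}" and res: "resolves_body_head D1 E1 C"
  shows "resolvent D E C"
proof -
  obtain r where r: "is_renaming r" "D1 = subst_clause r D"
    using assms(1) by (auto simp: is_variant_def)
  obtain s where s: "is_renaming s" "E1 = subst_clause s E"
    using assms(2) by (auto simp: is_variant_def)
  obtain r' where r': "is_subst r'" "comp_subst r' r = (id, id)" "comp_subst r r' = (id, id)"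
    using renaming_inverse[OF r(1)] by blast
  obtain s' where s': "is_subst s'" "comp_subst s' s = (id, id)" "comp_subst s s' = (id, id)"
    using renaming_inverse[OF s(1)] by blast
  have inv: "fst r' (fst r x) = x" "snd r' (snd r P) = P" "fst s' (fst s x) = x" "snd s' (snd s P) = P"
    for x P using r'(2) s'(2) by (auto simp: comp_subst_def fun_eq_iff)
  have inv': "fst r (fst r' x) = x" "snd r (snd r' P) = P" "fst s (fst s' x) = x" "snd s (snd s' P) = P"
    for x P using r'(3) s'(3) by (auto simp: comp_subst_def fun_eq_iff)
  have inj': "inj (fst r')" "inj (snd r')" "inj (fst s')" "inj (snd s')"
    by (rule inj_on_inverseI, rule inv')+
  \<comment> \<open>On the variables of \<open>D1\<close>, undo \<open>r\<close> and pass to the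
    even copy; elsewhere undo \<open>s\<close> and pass to the odd copy. By disjointness the second
    branch covers all variables of \<open>E1\<close>.\<close>
  define w where "w = (\<lambda>x. if x \<in> tvars D1 then fst to_even (fst r' x) else fst to_odd (fst s' x),
    \<lambda>P. if P \<in> pvars D1 then snd to_even (snd r' P) else snd to_odd (snd s' P))"
  have "inj_on (fst w) (tvars D1 \<union> tvars E1)"
    unfolding w_def fst_conv
    by (rule inj_on_case)
      (auto intro!: inj_onI simp: inj_eq inj' inj_to_even inj_to_odd to_even_neq_to_odd)
  moreover have "inj_on (snd w) (pvars D1 \<union> pvars E1)"
    unfolding w_def snd_conv
    by (rule inj_on_case)
      (auto intro!: inj_onI simp: inj_eq inj' inj_to_even inj_to_odd to_even_neq_to_odd)
  moreover have "is_subst w"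
    using r'(1) s'(1) by (auto simp: is_subst_def w_def to_even_def to_odd_def)
  ultimately obtain t where t: "is_renaming t"
    "\<And>x. x \<in> tvars D1 \<union> tvars E1 \<Longrightarrow> fst t x = fst w x"
    "\<And>P. P \<in> pvars D1 \<union> pvars E1 \<Longrightarrow> snd t P = snd w P"
    by (rule finite_injection_extends_to_renaming[rotated 2]) (auto simp: finite_tvars finite_pvars)
  obtain t' where t': "is_subst t'" "comp_subst t' t = (id, id)" "comp_subst t t' = (id, id)"
    using renaming_inverse[OF t(1)] by blast
  have tD: "subst_atom t (subst_atom r X) = subst_atom to_even X" if "X \<in> clause_atoms D" for X
    unfolding subst_atom_comp[symmetric]
    by (rule subst_atom_cong_clause[OF _ _ that])
      (auto simp: t r(2) tvars_subst pvars_subst w_def inv)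
  have tE: "subst_atom t (subst_atom s X) = subst_atom to_odd X" if "X \<in> clause_atoms E" for X
    unfolding subst_atom_comp[symmetric]
  proof (rule subst_atom_cong_clause[OF _ _ that])
    show "fst (comp_subst t s) x = fst to_odd x" if "x \<in> tvars E" for x
    proof -
      have "fst s x \<in> tvars E1" using that by (simp add: s(2) tvars_subst)
      with disj(1) have "fst s x \<notin> tvars D1" by blast
      with \<open>fst s x \<in> tvars E1\<close> show ?thesis by (simp add: t w_def inv)
    qed
    show "snd (comp_subst t s) P = snd to_odd P" if "P \<in> pvars E" for P
    proof -
      have "snd s P \<in> pvars E1" using that by (simp add: s(2) pvars_subst)
      with disj(2) have "snd s P \<notin> pvars D1" by blast
      with \<open>snd s P \<in> pvars E1\<close> show ?thesis by (simp add: t w_def inv)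
    qed
  qed
  obtain A1 B1 \<sigma> where A1: "A1 \<in># body D1" and B1: "head E1 = Some B1" and \<sigma>: "is_mgu \<sigma> A1 B1"
    and C: "C = subst_clause \<sigma> (Clause (head D1) ((body D1 - {#A1#}) + body E1))"
    using res by (auto simp: resolves_body_head_def)
  obtain A where A: "A \<in># body D" "A1 = subst_atom r A"
    using A1 by (auto simp: r(2) subst_clause_def)
  obtain B where B: "head E = Some B" "B1 = subst_atom s B"
    using B1 by (auto simp: s(2) subst_clause_def)
  have AB: "A \<in> clause_atoms D" "B \<in> clause_atoms E"
    using A B by (simp_all add: clause_atoms_def)
  \<comment> \<open>The m.g.u. is transported along \<open>t\<close>, so it now unifies the even
    copy of \<open>A\<close> with the odd copy of \<open>B\<close>.\<close>
  let ?\<sigma> = "comp_subst \<sigma> t'"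
  have \<sigma>t: "subst_atom \<sigma> X = subst_atom ?\<sigma> (subst_atom t X)" for X
    using t'(2) by (simp add: comp_subst_assoc flip: subst_atom_comp)
  have "is_subst t" using t(1) by (simp add: is_renaming_def)
  from is_mgu_renaming[OF \<sigma> this t']
  have m: "mg_pair (comp_subst ?\<sigma> to_even) (comp_subst ?\<sigma> to_odd) A B"
    by (intro mg_pair_of_mgu) (simp add: A(2) B(2) tD tE AB)
  have \<sigma>D: "subst_atom \<sigma> (subst_atom r X) = subst_atom (comp_subst ?\<sigma> to_even) X"
    if "X \<in> clause_atoms D" for X
    unfolding \<sigma>t tD[OF that] by (rule subst_atom_comp[symmetric])
  have \<sigma>E: "subst_atom \<sigma> (subst_atom s X) = subst_atom (comp_subst ?\<sigma> to_odd) X"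
    if "X \<in> clause_atoms E" for X
    unfolding \<sigma>t tE[OF that] by (rule subst_atom_comp[symmetric])
  have "C = Clause (map_option (subst_atom (comp_subst ?\<sigma> to_even)) (head D))
      (image_mset (subst_atom (comp_subst ?\<sigma> to_even)) (body D - {#A#}) +
       image_mset (subst_atom (comp_subst ?\<sigma> to_odd)) (body E))"
  proof -
    have "body D1 - {#A1#} = image_mset (subst_atom r) (body D - {#A#})"
      using A by (simp add: r(2) subst_clause_def image_mset_Diff)
    then have "C = Clause (map_option (\<lambda>X. subst_atom \<sigma> (subst_atom r X)) (head D))
      (image_mset (\<lambda>X. subst_atom \<sigma> (subst_atom r X)) (body D - {#A#}) +
       image_mset (\<lambda>X. subst_atom \<sigma> (subst_atom s X)) (body E))"
      by (simp add: C r(2) s(2) subst_clause_def option.map_comp multiset.map_comp comp_def)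
    also have "map_option (\<lambda>X. subst_atom \<sigma> (subst_atom r X)) (head D) =
        map_option (subst_atom (comp_subst ?\<sigma> to_even)) (head D)"
      by (rule option.map_cong0) (simp add: \<sigma>D clause_atoms_def)
    also have "image_mset (\<lambda>X. subst_atom \<sigma> (subst_atom r X)) (body D - {#A#}) =
        image_mset (subst_atom (comp_subst ?\<sigma> to_even)) (body D - {#A#})"
      by (rule image_mset_cong) (auto intro!: \<sigma>D simp: clause_atoms_def dest: in_diffD)
    also have "image_mset (\<lambda>X. subst_atom \<sigma> (subst_atom s X)) (body E) =
        image_mset (subst_atom (comp_subst ?\<sigma> to_odd)) (body E)"
      by (rule image_mset_cong) (simp add: \<sigma>E clause_atoms_def)
    finally show ?thesis .
  qed
  then show ?thesis
    using A(1) B(1) m unfolding resolvent_def by blast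
qed

text \<open>Eliminates variants from the rest of the proof. The two disjuncts record which premise
  supplies the body literal.\<close>

lemma sld_iff_resolvent: "sld C1 C2 C \<longleftrightarrow> resolvent C1 C2 C \<or> resolvent C2 C1 C"
proof
  assume "sld C1 C2 C"
  then obtain D1 D2 where D: "is_variant D1 C1" "is_variant D2 C2"
    "tvars D1 \<inter> tvars D2 = {}" "pvars D1 \<inter> pvars D2 = {}"
    and "resolves_body_head D1 D2 C \<or> resolves_body_head D2 D1 C"
    by (auto simp: sld_def)
  then show "resolvent C1 C2 C \<or> resolvent C2 C1 C"
    using resolvent_of_resolves_variants[of D1 C1 D2 C2 C]
      resolvent_of_resolves_variants[of D2 C2 D1 C1 C]
    by (auto simp: Int_commute)
next
  assume "resolvent C1 C2 C \<or> resolvent C2 C1 C"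
  then show "sld C1 C2 C"
  proof
    assume "resolvent C1 C2 C"
    then show ?thesis by (rule resolves_variants_of_resolvent) (auto simp: sld_def)
  next
    assume "resolvent C2 C1 C"
    then show ?thesis by (rule resolves_variants_of_resolvent) (auto simp: sld_def Int_commute)
  qed
qed

section \<open>Rearranging two successive resolutions\<close>

lemma image_mset_subst_comp:
  "image_mset (subst_atom \<rho>) (image_mset (subst_atom \<sigma>) M) = image_mset (subst_atom (comp_subst \<rho> \<sigma>)) M"
  by (simp add: multiset.map_comp comp_def subst_atom_comp[abs_def])

lemma map_option_subst_comp:
  "map_option (subst_atom \<rho>) (map_option (subst_atom \<sigma>) h) = map_option (subst_atom (comp_subst \<rho> \<sigma>)) h"
  by (simp add: option.map_comp comp_def subst_atom_comp[abs_def])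

text \<open>The head of \<open>E\<close> is an instance of the head of \<open>E1\<close>, so
  \<open>D\<close> can be resolved with \<open>E1\<close> first. The literal \<open>A1\<close>
  survives in the result and is then resolved against \<open>E2\<close>.\<close>

lemma resolvent_assoc_head:
  assumes "resolvent E1 E2 E" "resolvent D E C"
  obtains X where "resolvent D E1 X" "resolvent X E2 C"
proof -
  obtain A1 B1 \<alpha> \<beta> where A1: "A1 \<in># body E1" and B1: "head E2 = Some B1" and m1: "mg_pair \<alpha> \<beta> A1 B1"
    and E: "E = Clause (map_option (subst_atom \<alpha>) (head E1))
           (image_mset (subst_atom \<alpha>) (body E1 - {#A1#}) + image_mset (subst_atom \<beta>) (body E2))"
    using assms(1) by (auto simp: resolvent_def)
  obtain A B' \<gamma> \<delta> where A: "A \<in># body D" and B': "head E = Some B'" and m2: "mg_pair \<gamma> \<delta> A B'"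
    and C: "C = Clause (map_option (subst_atom \<gamma>) (head D))
           (image_mset (subst_atom \<gamma>) (body D - {#A#}) + image_mset (subst_atom \<delta>) (body E))"
    using assms(2) by (auto simp: resolvent_def)
  obtain B where B: "head E1 = Some B" "B' = subst_atom \<alpha> B" using B' E by auto
  obtain \<gamma>1 \<alpha>1 \<kappa> where x: "mg_pair \<gamma>1 \<alpha>1 A B"
    "mg_pair \<kappa> (comp_subst \<delta> \<beta>) (subst_atom \<alpha>1 A1) B1"
    "\<gamma> = comp_subst \<kappa> \<gamma>1" "comp_subst \<delta> \<alpha> = comp_subst \<kappa> \<alpha>1"
    using mg_pair_exchange[OF m1 m2[unfolded B(2)]] by blast
  obtain M where M: "body E1 = add_mset A1 M" using A1 by (metis multi_member_split)
  let ?X = "Clause (map_option (subst_atom \<gamma>1) (head D))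
     (image_mset (subst_atom \<gamma>1) (body D - {#A#}) + image_mset (subst_atom \<alpha>1) (body E1))"
  show thesis
  proof (rule that[of ?X])
    show "resolvent D E1 ?X" using A B(1) x(1) unfolding resolvent_def by blast
    show "resolvent ?X E2 C"
      unfolding resolvent_def
      by (intro exI[of _ "subst_atom \<alpha>1 A1"] exI[of _ B1] exI[of _ \<kappa>] exI[of _ "comp_subst \<delta> \<beta>"])
        (simp add: x B1 C E M image_mset_subst_comp map_option_subst_comp)
  qed
qed

text \<open>The literal of \<open>E\<close> that is resolved against \<open>D\<close> descends
  either from \<open>E1\<close> or from \<open>E2\<close>. In the first case two body literals of
  \<open>E1\<close> are eliminated in the other order; in the second, \<open>D\<close> is resolved
  into \<open>E2\<close> before \<open>E1\<close> uses the head of \<open>E2\<close>.\<close>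

lemma resolvent_assoc_body:
  assumes "resolvent E1 E2 E" "resolvent E D C"
  obtains X where "resolvent E1 D X" "resolvent X E2 C" | X where "resolvent E2 D X" "resolvent E1 X C"
proof -
  obtain A1 B1 \<alpha> \<beta> where A1: "A1 \<in># body E1" and B1: "head E2 = Some B1" and m1: "mg_pair \<alpha> \<beta> A1 B1"
    and E: "E = Clause (map_option (subst_atom \<alpha>) (head E1))
           (image_mset (subst_atom \<alpha>) (body E1 - {#A1#}) + image_mset (subst_atom \<beta>) (body E2))"
    using assms(1) by (auto simp: resolvent_def)
  obtain A' B \<delta> \<gamma> where A': "A' \<in># body E" and B: "head D = Some B" and m2: "mg_pair \<delta> \<gamma> A' B"
    and C: "C = Clause (map_option (subst_atom \<delta>) (head E))
           (image_mset (subst_atom \<delta>) (body E - {#A'#}) + image_mset (subst_atom \<gamma>) (body D))"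
    using assms(2) by (auto simp: resolvent_def)
  obtain M where M: "body E1 = add_mset A1 M" using A1 by (metis multi_member_split)
  consider A where "A \<in># M" "A' = subst_atom \<alpha> A" | A where "A \<in># body E2" "A' = subst_atom \<beta> A"
    using A' by (auto simp: E M)
  then show thesis
  proof cases
    case 1
    \<comment> \<open>\<open>A\<close> and \<open>A1\<close> are separate occurrences in the body of
      \<open>E1\<close> even when they are equal atoms, so removing \<open>A\<close> leaves
      \<open>A1\<close> available.\<close>
    obtain N where N: "M = add_mset A N" using 1 by (metis multi_member_split)
    obtain \<gamma>1 \<alpha>1 \<kappa> where x: "mg_pair \<gamma>1 \<alpha>1 B A"
      "mg_pair \<kappa> (comp_subst \<delta> \<beta>) (subst_atom \<alpha>1 A1) B1"
      "\<gamma> = comp_subst \<kappa> \<gamma>1" "comp_subst \<delta> \<alpha> = comp_subst \<kappa> \<alpha>1"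
      using mg_pair_exchange[OF m1 mg_pair_sym[OF m2[unfolded 1(2)]]] by blast
    let ?X = "Clause (map_option (subst_atom \<alpha>1) (head E1))
     (image_mset (subst_atom \<alpha>1) (body E1 - {#A#}) + image_mset (subst_atom \<gamma>1) (body D))"
    show thesis
    proof (rule that(1)[of ?X])
      show "resolvent E1 D ?X"
        unfolding resolvent_def
        by (intro exI[of _ A] exI[of _ B] exI[of _ \<alpha>1] exI[of _ \<gamma>1])
          (simp add: B mg_pair_sym[OF x(1)] M N)
      show "resolvent ?X E2 C"
        unfolding resolvent_def
        by (intro exI[of _ "subst_atom \<alpha>1 A1"] exI[of _ B1] exI[of _ \<kappa>] exI[of _ "comp_subst \<delta> \<beta>"])
          (simp add: x B1 C E M N 1(2) image_mset_subst_comp map_option_subst_comp ac_simps)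
    qed
  next
    case 2
    obtain N where N: "body E2 = add_mset A N" using 2 by (metis multi_member_split)
    obtain \<gamma>1 \<beta>1 \<kappa> where x: "mg_pair \<gamma>1 \<beta>1 B A"
      "mg_pair \<kappa> (comp_subst \<delta> \<alpha>) (subst_atom \<beta>1 B1) A1"
      "\<gamma> = comp_subst \<kappa> \<gamma>1" "comp_subst \<delta> \<beta> = comp_subst \<kappa> \<beta>1"
      \<comment> \<open>Here the literal comes from the \<beta> side, so the first pair is swapped
        before the exchange.\<close>
      using mg_pair_exchange[OF mg_pair_sym[OF m1] mg_pair_sym[OF m2[unfolded 2(2)]]] by blast
    let ?X = "Clause (map_option (subst_atom \<beta>1) (head E2))
     (image_mset (subst_atom \<beta>1) (body E2 - {#A#}) + image_mset (subst_atom \<gamma>1) (body D))"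
    show thesis
    proof (rule that(2)[of ?X])
      show "resolvent E2 D ?X"
        unfolding resolvent_def
        by (intro exI[of _ A] exI[of _ B] exI[of _ \<beta>1] exI[of _ \<gamma>1])
          (simp add: B mg_pair_sym[OF x(1)] N)
      show "resolvent E1 ?X C"
        unfolding resolvent_def
        by (intro exI[of _ A1] exI[of _ "subst_atom \<beta>1 B1"] exI[of _ "comp_subst \<delta> \<alpha>"] exI[of _ \<kappa>])
          (simp add: mg_pair_sym[OF x(2)] x(3,4) B1 C E M N 2(2) image_mset_subst_comp
            map_option_subst_comp ac_simps)
    qed
  qed
qed

text \<open>Written so that \<open>D\<close> absorbs \<open>E1\<close> and \<open>E2\<close> one at
  a time, in one of the two orders; this is the shape needed for linear derivations.\<close>

lemma sld_assoc:
  assumes "sld E1 E2 E" "sld D E C"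
  obtains X where "sld D E1 X" "sld X E2 C" | X where "sld D E2 X" "sld X E1 C"
proof -
  have "thesis" if E: "resolvent E1 E2 E"
    and *: "\<And>X. sld D E1 X \<Longrightarrow> sld X E2 C \<Longrightarrow> thesis" "\<And>X. sld D E2 X \<Longrightarrow> sld X E1 C \<Longrightarrow> thesis"
    for E1 E2
  proof -
    consider "resolvent D E C" | "resolvent E D C" using assms(2) by (auto simp: sld_iff_resolvent)
    then show thesis
    proof cases
      case 1
      show thesis using resolvent_assoc_head[OF E 1] *(1) by (auto simp: sld_iff_resolvent)
    next
      case 2
      show thesis using E 2
        by (rule resolvent_assoc_body) (auto simp: sld_iff_resolvent intro: *)
    qed
  qed
  then show thesis using assms(1) that by (auto simp: sld_iff_resolvent)
qed


section \<open>Derivability\<close>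

lemma derives_iff: "T \<turnstile>\<^sup>* C \<longleftrightarrow> (\<exists>n. C \<in> S n T)"
  by (simp add: derives_def)

lemma derives_step: "T \<turnstile>\<^sup>* D \<Longrightarrow> E \<in> T \<Longrightarrow> sld D E C \<Longrightarrow> T \<turnstile>\<^sup>* C"
proof -
  assume "T \<turnstile>\<^sup>* D" and E: "E \<in> T" "sld D E C"
  then obtain n where "D \<in> S n T" by (auto simp: derives_iff)
  with E have "C \<in> S (Suc n) T" by auto
  then show "T \<turnstile>\<^sup>* C" unfolding derives_iff by (rule exI)
qed

text \<open>Derivations are linear by definition; associativity makes them closed under resolution of two
  derived clauses.\<close>

lemma derives_sld:
  assumes "T \<turnstile>\<^sup>* D" "T \<turnstile>\<^sup>* E" "sld D E C"
  shows "T \<turnstile>\<^sup>* C"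
proof -
  obtain n where "E \<in> S n T" using assms(2) by (auto simp: derives_iff)
  with assms(1,3) show ?thesis
  \<comment> \<open>\<open>E2\<close> lies in \<open>T\<close>, so it is absorbed by a single step,
    while \<open>E1\<close> is absorbed by the induction hypothesis. When \<open>E2\<close> comes
    first, that hypothesis is applied to \<open>X\<close> in place of \<open>D\<close>.\<close>
  proof (induction n arbitrary: D E C)
    case 0
    then show ?case using derives_step by simp
  next
    case (Suc n)
    then obtain E1 E2 where E: "E1 \<in> S n T" "E2 \<in> T" "sld E1 E2 E" by auto
    from E(3) Suc.prems(2) show ?case
    proof (cases rule: sld_assoc)
      case (1 X)
      then show ?thesis using Suc E derives_step by blast
    next
      case (2 X)
      then show ?thesis using Suc E derives_step by blast
    qed
  qed
qed

lemma derives_of_reducible: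
  assumes "reducible F b" "\<And>C. C \<in> subfragment F \<infinity> (enat b) \<Longrightarrow> T \<turnstile>\<^sup>* C" "C \<in> F"
  shows "T \<turnstile>\<^sup>* C"
  using assms(3)
proof (induction "body_size C" arbitrary: C rule: less_induct)
  case less
  show ?case
  proof (cases "b < body_size C")
    case True
    then obtain b' C1 C2 where "b' < body_size C" "C1 \<in> subfragment F \<infinity> (enat b')"
      "C2 \<in> subfragment F \<infinity> (enat b')" and res: "sld C1 C2 C"
      using assms(1) less.prems unfolding reducible_def by blast
    then have "T \<turnstile>\<^sup>* C1" "T \<turnstile>\<^sup>* C2"
      using less.hyps[of C1] less.hyps[of C2] by (simp_all add: subfragment_def)
    then show ?thesis using res by (rule derives_sld)
  next
    case False
    then show ?thesis using less.prems by (intro assms(2)) (simp add: subfragment_def)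
  qed
qed

section \<open>Body sizes in the absence of facts\<close>

lemma resolvent_body_size:
  assumes "resolvent D E C"
  shows "Suc (body_size C) = body_size D + body_size E"
proof -
  obtain A \<alpha> \<beta> where A: "A \<in># body D" and C: "body C =
      image_mset (subst_atom \<alpha>) (body D - {#A#}) + image_mset (subst_atom \<beta>) (body E)"
    using assms unfolding resolvent_def by (metis clause.sel(2))
  obtain M where "body D = add_mset A M" using A by (metis multi_member_split)
  \<comment> \<open>Without factoring, literals that become equal stay separate occurrences, so the
    count is exact: only the resolved literal disappears.\<close>
  then show ?thesis by (simp add: body_size_def C)
qed

lemma resolvent_nonempty_bodies:
  assumes "resolvent D E C" "\<not> is_fact E"
  shows "0 < body_size D" "0 < body_size E"
proof -
  have "body D \<noteq> {#}" "head E \<noteq> None"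
    using assms(1) unfolding resolvent_def by (metis empty_iff set_mset_empty, metis option.distinct(1))
  then show "0 < body_size D" "0 < body_size E"
    using assms(2) by (auto simp: body_size_def is_fact_def nonempty_has_size)
qed

text \<open>A premise that is used through its head and is not a fact has a nonempty body, so it
  brings in at least as many literals as the one it replaces.\<close>

lemma sld_body_size_ge:
  assumes "sld D E C" "\<not> is_fact D" "\<not> is_fact E"
  shows "body_size D \<le> body_size C" "body_size E \<le> body_size C" "\<not> is_fact C"
proof -
  have "Suc (body_size C) = body_size D + body_size E \<and> 0 < body_size D \<and> 0 < body_size E"
    using assms(1) unfolding sld_iff_resolvent
  proof
    assume "resolvent D E C"
    then show ?thesis
      using assms(3) by (simp add: resolvent_body_size resolvent_nonempty_bodies)
  next
    assume "resolvent E D C"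
    then show ?thesis
      using assms(2) resolvent_body_size[of E D C] resolvent_nonempty_bodies[of E D C] by simp
  qed
  then show "body_size D \<le> body_size C" "body_size E \<le> body_size C" "\<not> is_fact C"
    by (auto simp: is_fact_def body_size_def)
qed

text \<open>Sizes never decrease along such a derivation, so every clause used for \<open>X\<close>
  is shorter than \<open>C\<close> and thus differs from it. Being no fact is carried through the
  induction because the size bound relies on it.\<close>

lemma S_drop_large_clause:
  assumes "\<forall>X\<in>T. \<not> is_fact X" "X \<in> S n T"
  shows "\<not> is_fact X \<and> (body_size X < body_size C \<longrightarrow> X \<in> S n (T - {C}))"
  using assms(2)
proof (induction n arbitrary: X)
  case 0
  then have "X \<in> T" by simp
  with assms(1) show ?case by (cases "X = C") simp_all
next
  case (Suc n)
  from Suc.prems obtain X1 X2 where X: "X1 \<in> S n T" "X2 \<in> T" "sld X1 X2 X" by auto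
  have nf: "\<not> is_fact X1" "\<not> is_fact X2" using Suc.IH[OF X(1)] X(2) assms(1) by auto
  note ge = sld_body_size_ge[OF X(3) nf]
  have "X \<in> S (Suc n) (T - {C})" if "body_size X < body_size C"
  proof -
    have "X1 \<in> S n (T - {C})" using Suc.IH[OF X(1)] ge that by simp
    moreover have "X2 \<in> T - {C}" using X(2) ge that by auto
    ultimately show ?thesis using X(3) by auto
  qed
  then show ?case using ge(3) by blast
qed

text \<open>Facts are excluded because resolving with a fact shortens a clause, so a derivation of a
  short clause could otherwise pass through \<open>C\<close> itself.\<close>

lemma reduction_core_subset_subfragment:
  assumes "reducible F b" "\<forall>C\<in>F. \<not> is_fact C" "reduction_core F T"
  shows "T \<subseteq> subfragment F \<infinity> (enat b)"
proof
  fix C assume C: "C \<in> T"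
  have T: "T \<subseteq> F" "\<And>X. X \<in> F \<Longrightarrow> T \<turnstile>\<^sup>* X" "\<not> (T - {C}) \<turnstile>\<^sup>* C"
    using assms(3) C
    unfolding reduction_core_def redundant_to_def reduced_def redundant_clause_def by blast+
  have small: "(T - {C}) \<turnstile>\<^sup>* X" if X: "X \<in> F" "body_size X < body_size C" for X
  proof -
    obtain n where "X \<in> S n T" using T(2)[OF X(1)] by (auto simp: derives_iff)
    moreover have "\<forall>X\<in>T. \<not> is_fact X" using T(1) assms(2) by blast
    ultimately have "X \<in> S n (T - {C})" using S_drop_large_clause X(2) by blast
    then show ?thesis by (auto simp: derives_iff)
  qed
  have "\<not> b < body_size C"
  proof
    assume "b < body_size C"
    then obtain b' C1 C2 where "b' < body_size C" "C1 \<in> subfragment F \<infinity> (enat b')"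
      "C2 \<in> subfragment F \<infinity> (enat b')" and res: "sld C1 C2 C"
      using assms(1) C T(1) unfolding reducible_def by blast
    then have "(T - {C}) \<turnstile>\<^sup>* C1" "(T - {C}) \<turnstile>\<^sup>* C2"
      using small[of C1] small[of C2] by (simp_all add: subfragment_def)
    then have "(T - {C}) \<turnstile>\<^sup>* C" using res by (rule derives_sld)
    with T(3) show False by contradiction
  qed
  then show "C \<in> subfragment F \<infinity> (enat b)"
    using C T(1) by (auto simp: subfragment_def)
qed

theorem mainTheorem2:
  fixes F :: "clause set" and b :: nat
  assumes "fragment F"
    and "reducible F b"
  shows "((\<forall>C\<in>F. \<not> is_fact C) \<longrightarrow>
            {T. reduction_core F T} = {T. reduction_core (subfragment F \<infinity> (enat b)) T})
       \<and> {T. reduction_core F T \<and> T \<subseteq> subfragment F \<infinity> (enat b)}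
            = {T. reduction_core (subfragment F \<infinity> (enat b)) T}"
proof -
  let ?G = "subfragment F \<infinity> (enat b)"
  have G: "?G \<subseteq> F" by (auto simp: subfragment_def)
  \<comment> \<open>Finiteness and being reduced concern \<open>T\<close> alone. Deriving all of
    \<open>F\<close> and deriving all of \<open>?G\<close> are equivalent by reducibility, with no
    assumption on facts.\<close>
  have core: "reduction_core F T \<and> T \<subseteq> ?G \<longleftrightarrow> reduction_core ?G T" for T
  proof -
    have "(\<forall>C\<in>F. T \<turnstile>\<^sup>* C) \<longleftrightarrow> (\<forall>C\<in>?G. T \<turnstile>\<^sup>* C)"
      using G by (meson assms(2) derives_of_reducible subsetD)
    with G show ?thesis unfolding reduction_core_def redundant_to_def by blast
  qed
  \<comment> \<open>Without facts every core of \<open>F\<close> lies in \<open>?G\<close>, so the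
    side condition in \<open>core\<close> holds automatically and the first equation follows from
    the second.\<close>
  then show ?thesis
    using reduction_core_subset_subfragment[OF assms(2)] by blast
qed

end
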